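(* Let $C$ be an $(n,k)_2$-MDS code over an alphabet of size $2$, identified with $\{0,1\}=\mathbb{F}_2$. Then $C$ is equivalent to a linear binary MDS code. Thus $C$ is equivalent to one of the following: the $[n,1]_2$ repetition code $\{00\cdots 0,\,11\cdots 1\}$ (with $k=1$), the $[n,n]_2$ universe code $\mathbb{F}_2^n$ (with $k=n$), or the $[k+1,k]_2$ single-parity-check code consisting of all words of even Hamming weight in $\mathbb{F}_2^{k+1}$ (with $n=k+1$).
   Context: Let $\mathcal{A}$ be a finite alphabet of size $q\ge 2$ and let $1\le k\le n$ be integers. The Hamming distance of $a,b\in\mathcal{A}^n$ is the number of coordinates in which they differ. An $(n,k)_q$ code is a subset $C\subseteq\mathcal{A}^n$ with $|C|=q^k$; no linearity is assumed. Its minimum distance $d$ is the minimum Hamming distance between distinct codewords; it satisfies $d\le n-k+1$, and $C$ is called an $(n,k)_q$-MDS code if $d=n-k+1$. A code is linear if $\mathcal{A}=\mathbb{F}_q$ and its codewords form a $k$-dimensional subspace of $\mathbb{F}_q^n$ (notation $[n,k]_q$). Two codes are equivalent if one can be obtained from the other by a finite sequence of operations of the following two kinds: (SP) fix a coordinate position and apply a permutation of the alphabet to all entries in that position; (PP) choose two coordinate positions and exchange their entries in every codeword. The Hamming weight of a binary word is the number of its nonzero coordinates. *)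

theory Defs
  imports "HOL-Analysis.Analysis" "HOL-Library.Z2"
begin

text \<open>Words of length \<open>n = CARD('n)\<close> over the alphabet \<open>'a\<close> are elements of \<open>'a ^ 'n\<close>;
  the binary alphabet with its field structure is \<open>bit\<close>.\<close>

instance bit :: finite
proof
  have "(UNIV :: bit set) \<subseteq> {0, 1}"
    by (auto intro: bit_not_zero_iff [THEN iffD1])
  then show "finite (UNIV :: bit set)"
    by (rule finite_subset) simp
qed

definition hamming_dist :: "'a ^ 'n \<Rightarrow> 'a ^ 'n \<Rightarrow> nat" where
  "hamming_dist x y = card {i. x $ i \<noteq> y $ i}"

definition hamming_weight :: "bit ^ 'n \<Rightarrow> nat" where
  "hamming_weight x = card {i. x $ i \<noteq> 0}"

definition is_code :: "nat \<Rightarrow> ('a::finite ^ 'n) set \<Rightarrow> bool" where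
  "is_code k C \<longleftrightarrow>
     2 \<le> CARD('a) \<and> 1 \<le> k \<and> k \<le> CARD('n) \<and> card C = CARD('a) ^ k"

text \<open>Only meaningful for sets with at least two words, which every code has.\<close>

definition min_dist :: "('a::finite ^ 'n) set \<Rightarrow> nat" where
  "min_dist C = Min {hamming_dist x y | x y. x \<in> C \<and> y \<in> C \<and> x \<noteq> y}"

definition mds_code :: "nat \<Rightarrow> ('a::finite ^ 'n) set \<Rightarrow> bool" where
  "mds_code k C \<longleftrightarrow> is_code k C \<and> min_dist C = CARD('n) - k + 1"

definition linear_code :: "nat \<Rightarrow> ('a::{field,finite} ^ 'n) set \<Rightarrow> bool" where
  "linear_code k C \<longleftrightarrow> is_code k C \<and> vec.subspace C \<and> vec.dim C = k"

definition permute_symbols :: "'n \<Rightarrow> ('a \<Rightarrow> 'a) \<Rightarrow> 'a ^ 'n \<Rightarrow> 'a ^ 'n" where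
  "permute_symbols i \<pi> x = (\<chi> l. if l = i then \<pi> (x $ l) else x $ l)"

definition swap_positions :: "'n \<Rightarrow> 'n \<Rightarrow> 'a ^ 'n \<Rightarrow> 'a ^ 'n" where
  "swap_positions i j x = (\<chi> l. if l = i then x $ j else if l = j then x $ i else x $ l)"

inductive code_step :: "('a ^ 'n) set \<Rightarrow> ('a ^ 'n) set \<Rightarrow> bool" where
  SP: "bij \<pi> \<Longrightarrow> code_step C (permute_symbols i \<pi> ` C)"
| PP: "i \<noteq> j \<Longrightarrow> code_step C (swap_positions i j ` C)"

definition code_equivalent :: "('a ^ 'n) set \<Rightarrow> ('a ^ 'n) set \<Rightarrow> bool" where
  "code_equivalent = code_step\<^sup>*\<^sup>*"

definition repetition_code :: "(bit ^ 'n) set" where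
  "repetition_code = {\<chi> i. 0, \<chi> i. 1}"

definition universe_code :: "(bit ^ 'n) set" where
  "universe_code = UNIV"

definition parity_check_code :: "(bit ^ 'n) set" where
  "parity_check_code = {x. even (hamming_weight x)}"

end

theory Submission
  imports Defs
begin

text \<open>Translating by a codeword is a composition of symbol permutations, so assume \<open>0 \<in> C\<close>.
  An MDS code with \<open>q\<^sup>k\<close> words projects bijectively onto any \<open>k\<close> coordinates. For \<open>k = n\<close> this
  gives the universe code, and for \<open>k = 1\<close> the nonzero word must differ from \<open>0\<close> everywhere.
  If \<open>n = k + 1\<close>, exactly one of \<open>x\<close> and \<open>x + e\<^sub>i\<close> is a codeword, for all \<open>x\<close> and \<open>i\<close>, so \<open>C\<close>
  consists of the words of even weight. If \<open>2 \<le> k \<le> n - 2\<close>, the codewords projecting onto two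
  unit vectors of \<open>\<bbbF>\<^sub>2\<^sup>k\<close> have weight at least \<open>n - k + 1\<close>, hence are constantly \<open>1\<close> on the other
  coordinates; their distance is then \<open>2 < n - k + 1\<close>, a contradiction.\<close>

lemma bit_neq_iff: "a \<noteq> b \<longleftrightarrow> a = b + 1" for a b :: bit
  by (cases a; cases b) auto

lemma card_UNIV_bit: "CARD(bit) = 2"
proof -
  have "(UNIV :: bit set) = {0, 1}"
    by (auto intro: bit_not_zero_iff [THEN iffD1])
  then show ?thesis by (metis card_2_iff zero_neq_one)
qed

section \<open>Agreement and interpolation on \<open>k\<close> positions\<close>

lemma hamming_dist_le_if_agree:
  fixes x y :: "'a ^ 'n"
  assumes "\<And>i. i \<in> S \<Longrightarrow> x $ i = y $ i"
  shows "hamming_dist x y \<le> CARD('n) - card S"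
proof -
  have "hamming_dist x y \<le> card (- S)"
    unfolding hamming_dist_def using assms by (intro card_mono) auto
  then show ?thesis by (simp add: Compl_eq_Diff_UNIV card_Diff_subset)
qed

lemma min_dist_le_hamming_dist:
  fixes C :: "('a::finite ^ 'n) set"
  assumes "x \<in> C" "y \<in> C" "x \<noteq> y"
  shows "min_dist C \<le> hamming_dist x y"
proof -
  have "finite {hamming_dist x y | x y. x \<in> C \<and> y \<in> C \<and> x \<noteq> y}"
    by (rule finite_subset [where B = "(\<lambda>(x, y). hamming_dist x y) ` UNIV"]) auto
  then show ?thesis
    unfolding min_dist_def using assms by (intro Min_le) auto
qed

text \<open>Agreement on \<open>k\<close> of the \<open>n\<close> positions leaves distance at most
  \<open>n - k\<close>, one less than the minimum distance.\<close>

lemma mds_code_agree_imp_eq: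
  fixes C :: "('a::finite ^ 'n) set"
  assumes "mds_code k C" "card S = k" "x \<in> C" "y \<in> C" "\<And>i. i \<in> S \<Longrightarrow> x $ i = y $ i"
  shows "x = y"
proof (rule ccontr)
  assume "x \<noteq> y"
  then have "CARD('n) - k + 1 \<le> hamming_dist x y"
    using min_dist_le_hamming_dist [of x C y] assms unfolding mds_code_def by simp
  with hamming_dist_le_if_agree [of S x y] assms show False by simp
qed

text \<open>By the preceding lemma, projection to \<open>S\<close> is injective on \<open>C\<close>,
  and both sides have \<open>q ^ k\<close> elements, so it is onto.\<close>

lemma mds_code_interpolation:
  fixes C :: "('a::finite ^ 'n) set"
  assumes "mds_code k C" "card S = k"
  obtains x where "x \<in> C" "\<And>i. i \<in> S \<Longrightarrow> x $ i = f i"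
proof -
  \<comment> \<open>\<open>restrict\<close> fixes a default value off \<open>S\<close>, so the
    target space of functions has exactly \<open>q ^ k\<close> members.\<close>
  let ?g = "\<lambda>x :: 'a ^ 'n. restrict (($) x) S"
  have inj: "inj_on ?g C"
    using mds_code_agree_imp_eq [OF assms] by (intro inj_onI) (metis restrict_apply')
  have "?g ` C = S \<rightarrow>\<^sub>E UNIV"
  proof (rule card_subset_eq)
    show "card (?g ` C) = card (S \<rightarrow>\<^sub>E (UNIV :: 'a set))"
      using assms by (simp add: card_image [OF inj] card_PiE mds_code_def is_code_def)
  qed (auto intro: finite_PiE)
  then have "restrict f S \<in> ?g ` C" by simp
  then obtain x where "x \<in> C" "restrict f S = ?g x" by blast
  then show ?thesis using that by (metis restrict_apply')
qed

section \<open>Translations\<close>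

lemma code_equivalent_translate:
  fixes C :: "('a::ab_group_add ^ 'n) set"
  shows "code_equivalent C ((+) c ` C)"
proof -
  \<comment> \<open>\<open>t S\<close> translates only the positions in \<open>S\<close>; adding one
    position to \<open>S\<close> costs one SP step.\<close>
  define t where "t S x = (\<chi> l. if l \<in> S then c $ l + x $ l else x $ l)" for S and x :: "'a ^ 'n"
  have "code_equivalent C (t S ` C)" for S
    using finite [of S]
  proof (induction S)
    case empty
    have "t {} = id" by (simp add: t_def fun_eq_iff vec_eq_iff)
    then show ?case by (simp add: code_equivalent_def)
  next
    case (insert i S)
    have "bij ((+) (c $ i))" by simp
    then have "code_step (t S ` C) (permute_symbols i ((+) (c $ i)) ` t S ` C)"
      by (rule SP)
    moreover have "permute_symbols i ((+) (c $ i)) (t S x) = t (insert i S) x" for x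
      using insert.hyps by (auto simp: t_def permute_symbols_def vec_eq_iff)
    ultimately show ?case
      using insert.IH unfolding code_equivalent_def
      by (simp add: image_image rtranclp.rtrancl_into_rtrancl)
  qed
  moreover have "t UNIV = (+) c" by (simp add: t_def fun_eq_iff vec_eq_iff)
  ultimately show ?thesis by metis
qed

lemma mds_code_translate:
  fixes C :: "('a::{ab_group_add,finite} ^ 'n) set"
  assumes "mds_code k C"
  shows "mds_code k ((+) c ` C)"
proof -
  have "hamming_dist (c + x) (c + y) = hamming_dist x y" for x y
    by (simp add: hamming_dist_def)
  then have "{hamming_dist x y | x y. x \<in> (+) c ` C \<and> y \<in> (+) c ` C \<and> x \<noteq> y} =
             {hamming_dist x y | x y. x \<in> C \<and> y \<in> C \<and> x \<noteq> y}"
    by (auto simp: image_iff) (metis add_left_cancel)+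
  then show ?thesis
    using assms by (simp add: mds_code_def is_code_def min_dist_def card_image)
qed

section \<open>Linearity of the three target codes\<close>

text \<open>Each new basis vector \<open>b\<close> multiplies the size by the number of scalars,
  since every vector of the larger span is \<open>scale r b + v\<close> for a unique pair
  \<open>(r, v)\<close> with \<open>v\<close> in the old span.\<close>

lemma (in vector_space) card_span_independent:
  assumes "finite B" "independent B"
  shows "card (span B) = CARD('a) ^ card B"
  using assms
proof (induction B)
  case empty
  then show ?case by simp
next
  case (insert b B)
  have b: "b \<notin> span B" and B: "independent B"
    using insert by (auto simp: independent_insert)
  let ?f = "\<lambda>(r, v). scale r b + v"
  have "inj_on ?f (UNIV \<times> span B)"
  proof (intro inj_onI, clarify)
    fix r v r' v'
    assume v: "v \<in> span B" "v' \<in> span B" and eq: "scale r b + v = scale r' b + v'"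
    then have "scale (r - r') b = v' - v" by (simp add: algebra_simps)
    then have "scale (r - r') b \<in> span B" using v by (simp add: span_diff)
    \<comment> \<open>Otherwise dividing by \<open>r - r'\<close> would put \<open>b\<close> into
      \<open>span B\<close>.\<close>
    then have "r = r'" using b span_scale [of "scale (r - r') b" B "inverse (r - r')"] by (cases "r = r'") auto
    with eq show "r = r' \<and> v = v'" by simp
  qed
  moreover have "?f ` (UNIV \<times> span B) = span (insert b B)"
  proof (intro equalityI subsetI)
    fix x assume "x \<in> span (insert b B)"
    then obtain r where "x - scale r b \<in> span B" by (auto simp: span_insert)
    then show "x \<in> ?f ` (UNIV \<times> span B)"
      by (intro image_eqI [where x = "(r, x - scale r b)"]) auto
  qed (auto intro!: span_add span_scale intro: span_base subsetD [OF span_mono [OF subset_insertI]])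
  ultimately have "card (span (insert b B)) = CARD('a) * card (span B)"
    by (metis card_image card_cartesian_product)
  then show ?case using insert B by simp
qed

text \<open>The dimension is forced: a subspace has \<open>q ^ dim\<close> elements, and powers of
  \<open>q \<ge> 2\<close> determine their exponent.\<close>

lemma linear_codeI:
  fixes C :: "('a::{field,finite} ^ 'n) set"
  assumes "is_code k C" "vec.subspace C"
  shows "linear_code k C"
proof -
  obtain B where "B \<subseteq> C" "vec.independent B" "C = vec.span B" "card B = vec.dim C"
    using assms(2) by (metis vec.basis_exists vec.span_eq_iff vec.span_mono subset_antisym)
  then have "CARD('a) ^ vec.dim C = CARD('a) ^ k"
    using vec.card_span_independent [of B] assms(1) by (simp add: is_code_def)
  then show ?thesis
    using assms by (auto simp: linear_code_def is_code_def)
qed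

text \<open>The coordinate sum in \<open>bit\<close> is the weight modulo 2, which turns parity into
  a linear equation.\<close>

lemma even_hamming_weight_iff: "even (hamming_weight x) \<longleftrightarrow> (\<Sum>i\<in>UNIV. x $ i) = 0"
proof -
  have "(\<Sum>i\<in>UNIV. x $ i) = (\<Sum>i | x $ i \<noteq> 0. 1)"
    by (rule sum.mono_neutral_cong_right) auto
  then have "(\<Sum>i\<in>UNIV. x $ i) = of_nat (hamming_weight x)"
    by (simp add: hamming_weight_def)
  moreover have "(of_nat m :: bit) = 0 \<longleftrightarrow> even m" for m
    by (induction m) (auto simp: bit_neq_iff)
  ultimately show ?thesis by simp
qed

lemma subspace_parity_check_code: "vec.subspace parity_check_code"
  unfolding vec.subspace_def parity_check_code_def even_hamming_weight_iff mem_Collect_eq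
    vector_add_component vector_smult_component sum.distrib sum_distrib_left [symmetric]
  by simp

lemma subspace_repetition_code: "vec.subspace repetition_code"
  by (auto simp: vec.subspace_def repetition_code_def vec_eq_iff)

lemma subspace_universe_code: "vec.subspace universe_code"
  by (simp add: vec.subspace_def universe_code_def)

section \<open>Identification of the code for each admissible \<open>k\<close>\<close>

lemma mds_code_eq_universe_code:
  fixes C :: "(bit ^ 'n) set"
  assumes "mds_code CARD('n) C"
  shows "C = universe_code"
proof -
  have "x \<in> C" for x
    using mds_code_interpolation [OF assms, of UNIV "($) x"] by (metis UNIV_I vec_eq_iff)
  then show ?thesis by (auto simp: universe_code_def)
qed

lemma mds_code_eq_repetition_code:
  fixes C :: "(bit ^ 'n) set"
  assumes mds: "mds_code 1 C" and "0 \<in> C"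
  shows "C = repetition_code"
proof -
  have "card C = 2" using mds by (simp add: mds_code_def is_code_def card_UNIV_bit)
  then obtain c where "C = {0, c}" "c \<noteq> 0"
    using \<open>0 \<in> C\<close> by (auto simp: card_2_iff)
  \<comment> \<open>A zero at \<open>i\<close> would make \<open>c\<close> and \<open>0\<close>
    agree on the one-element set \<open>{i}\<close>.\<close>
  moreover have "c $ i = 1" for i
    using mds_code_agree_imp_eq [OF mds, of "{i}" c 0] calculation by (cases "c $ i") auto
  ultimately show ?thesis
    by (auto simp: repetition_code_def vec_eq_iff)
qed

lemma mds_code_eq_parity_check_code:
  fixes C :: "(bit ^ 'n) set"
  assumes mds: "mds_code k C" and n: "CARD('n) = k + 1" and "0 \<in> C"
  shows "C = parity_check_code"
proof -
  \<comment> \<open>The two words agree on the \<open>k\<close> positions other than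
    \<open>i\<close>, so at most one is in \<open>C\<close>. Interpolating \<open>x\<close> there
    gives a codeword, which must be one of the two because position \<open>i\<close> admits only two
    symbols.\<close>
  have flip: "x \<in> C \<longleftrightarrow> x + axis i 1 \<notin> C" for x i
  proof -
    have S: "card (UNIV - {i}) = k" using n by simp
    have agree: "x $ j = (x + axis i 1) $ j" if "j \<in> UNIV - {i}" for j
      using that by (simp only: vector_add_component axis_def vec_lambda_beta) simp
    have "x \<noteq> x + axis i 1"
      by (simp only: axis_eq_0_iff add_cancel_left_right add_cancel_right_right) simp
    then have "\<not> (x \<in> C \<and> x + axis i 1 \<in> C)"
      using mds_code_agree_imp_eq [OF mds S _ _ agree] by blast
    moreover obtain y where y: "y \<in> C" "\<And>j. j \<in> UNIV - {i} \<Longrightarrow> y $ j = x $ j"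
      using mds_code_interpolation [OF mds S, of "($) x"] by metis
    have "y = x \<or> y = x + axis i 1"
    proof (cases "y $ i = x $ i")
      case True
      then have "y $ j = x $ j" for j using y(2) by (cases "j = i") auto
      then show ?thesis by (simp add: vec_eq_iff)
    next
      case False
      then have "y $ i = (x + axis i 1) $ i"
        by (simp only: bit_neq_iff vector_add_component axis_def vec_lambda_beta simp_thms if_True)
      then have "y $ j = (x + axis i 1) $ j" for j
        using y(2) agree by (metis DiffI UNIV_I singletonD)
      then show ?thesis by (metis vec_eq_iff)
    qed
    ultimately show ?thesis using y(1) by blast
  qed
  have "x \<in> C \<longleftrightarrow> even (hamming_weight x)" for x
  \<comment> \<open>Clearing a one of \<open>x\<close> lowers the weight by one and, by
    \<open>flip\<close>, toggles membership in \<open>C\<close>.\<close>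
  proof (induction "hamming_weight x" arbitrary: x)
    case 0
    then have "x = 0" by (auto simp: hamming_weight_def vec_eq_iff)
    then show ?case using \<open>0 \<in> C\<close> by (simp add: hamming_weight_def)
  next
    case (Suc m)
    then have "{i. x $ i \<noteq> 0} \<noteq> {}"
      unfolding hamming_weight_def by (metis card.empty nat.distinct(1))
    then obtain i where i: "x $ i = 1" by auto
    have "(x + axis i 1) $ j \<noteq> 0 \<longleftrightarrow> x $ j \<noteq> 0 \<and> j \<noteq> i" for j
      using i by (cases "j = i") (auto simp: axis_def)
    then have "{j. (x + axis i 1) $ j \<noteq> 0} = {j. x $ j \<noteq> 0} - {i}"
      by blast
    then have "hamming_weight (x + axis i 1) = m"
      using Suc.hyps(2) i by (simp add: hamming_weight_def)
    then show ?case
      using Suc.hyps flip [of x i] by (metis even_Suc)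
  qed
  then show ?thesis by (auto simp: parity_check_code_def)
qed

section \<open>Exclusion of all other parameters\<close>

lemma mds_code_trivial_parameters:
  fixes C :: "(bit ^ 'n) set"
  assumes mds: "mds_code k C" and "0 \<in> C"
  shows "k = 1 \<or> CARD('n) \<le> k + 1"
proof (rule ccontr)
  assume "\<not> ?thesis"
  with mds have k: "2 \<le> k" "k + 2 \<le> CARD('n)"
    by (auto simp: mds_code_def is_code_def)
  then obtain S :: "'n set" where S: "card S = k"
    using obtain_subset_with_card_n [of k "UNIV :: 'n set"] by auto
  then obtain a b where ab: "a \<in> S" "b \<in> S" "a \<noteq> b"
    using k(1) by (metis card_le_Suc0_iff_eq finite not_less_eq_eq numeral_2_eq_2)
  have unit: "\<exists>x\<in>C. (\<forall>i\<in>S. x $ i = (if i = j then 1 else 0)) \<and> (\<forall>i. i \<notin> S \<longrightarrow> x $ i = 1)"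
    if j: "j \<in> S" for j
  proof -
    obtain x where x: "x \<in> C" "\<And>i. i \<in> S \<Longrightarrow> x $ i = (if i = j then 1 else 0)"
      using mds_code_interpolation [OF mds S, of "\<lambda>i. if i = j then 1 else 0"] by metis
    have "x $ i \<noteq> 0" if i: "i \<notin> S" for i
    proof
      assume "x $ i = 0"
      \<comment> \<open>Trading \<open>j\<close>, where \<open>x\<close> is 1, for the supposed zero
        at \<open>i\<close> gives \<open>k\<close> positions on which \<open>x\<close> agrees with
        \<open>0\<close>.\<close>
      moreover have "card (insert i (S - {j})) = k"
        using i j S k by simp
      moreover have "x $ l = 0" if "l \<in> S - {j}" for l
        using x(2) that by simp
      ultimately have "x = 0"
        using mds_code_agree_imp_eq [OF mds _ x(1) \<open>0 \<in> C\<close>, of "insert i (S - {j})"] by auto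
      with x(2) [OF j] show False by simp
    qed
    with x show ?thesis by (intro bexI [of _ x]) auto
  qed
  obtain x where x: "x \<in> C" "\<forall>i\<in>S. x $ i = (if i = a then 1 else 0)" "\<forall>i. i \<notin> S \<longrightarrow> x $ i = 1"
    using unit [OF ab(1)] by auto
  obtain y where y: "y \<in> C" "\<forall>i\<in>S. y $ i = (if i = b then 1 else 0)" "\<forall>i. i \<notin> S \<longrightarrow> y $ i = 1"
    using unit [OF ab(2)] by auto
  have neq: "x \<noteq> y" using x y ab by (metis zero_neq_one)
  \<comment> \<open>The words differ at most in \<open>a\<close> and \<open>b\<close>, while
    \<open>k + 2 \<le> n\<close> makes the minimum distance at least 3.\<close>
  have "hamming_dist x y \<le> CARD('n) - card (UNIV - {a, b})"
  proof (rule hamming_dist_le_if_agree)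
    show "x $ i = y $ i" if "i \<in> UNIV - {a, b}" for i
      using x y that by (cases "i \<in> S") auto
  qed
  also have "\<dots> = 2" using ab(3) k by (simp add: card_Diff_subset)
  finally show False
    using min_dist_le_hamming_dist [OF x(1) y(1) neq] mds k by (simp add: mds_code_def)
qed

theorem theorem4:
  fixes C :: "(bit ^ 'n) set" and k :: nat
  assumes "mds_code k C"
  shows "\<exists>D. code_equivalent C D \<and> linear_code k D \<and> mds_code k D \<and>
           (k = 1 \<and> D = repetition_code \<or>
            k = CARD('n) \<and> D = universe_code \<or>
            CARD('n) = k + 1 \<and> D = parity_check_code)"
proof -
  have "card C \<noteq> 0"
    using assms by (simp add: mds_code_def is_code_def)
  then obtain c where c: "c \<in> C"
    by (metis card.empty ex_in_conv)
  define D where "D = (+) (- c) ` C"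
  have mds: "mds_code k D"
    unfolding D_def using assms by (rule mds_code_translate)
  have "0 \<in> D"
    unfolding D_def using c by force
  have "k \<le> CARD('n)"
    using mds by (simp add: mds_code_def is_code_def)
  \<comment> \<open>If \<open>k \<noteq> 1\<close>, then \<open>k \<le> n \<le> k + 1\<close> leaves
    only the two values of \<open>n\<close>.\<close>
  then have D: "k = 1 \<and> D = repetition_code \<or>
             k = CARD('n) \<and> D = universe_code \<or>
             CARD('n) = k + 1 \<and> D = parity_check_code"
    using mds_code_trivial_parameters [OF mds \<open>0 \<in> D\<close>] mds \<open>0 \<in> D\<close>
      mds_code_eq_repetition_code mds_code_eq_universe_code mds_code_eq_parity_check_code
    by (metis Suc_eq_plus1 le_SucE le_antisym)
  then have "vec.subspace D"
    using subspace_repetition_code subspace_universe_code subspace_parity_check_code by metis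
  with mds have "linear_code k D"
    by (simp add: linear_codeI mds_code_def)
  then show ?thesis
    using code_equivalent_translate mds D unfolding D_def by blast
qed

end
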